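(* Let $G$ be a group. Every separating family of finite-index normal subgroups of $G$ is semi-conjugacy-separating. The same is true for any family $\sigma$ of finite-index subgroups of $G$ satisfying that there exists a separating family $\tau$ of finite-index normal subgroups of $G$ such that for any $G_\beta\in\tau$ there is $G_\alpha\in\sigma$ such that $G_\alpha$ is a subgroup of $G_\beta$.
   Context: A family $\sigma$ of finite-index subgroups of $G$ is called separating if for any non-empty finite subset $F\subset G\setminus\{1\}$ there is $G_\alpha\in\sigma$ such that $g\notin G_\alpha$ for any $g\in F$. It is called semi-conjugacy-separating if for any non-empty finite subset $F\subset G$ there is $G_\alpha\in\sigma$ such that $G_\alpha\cap g^G G_\alpha=\varnothing$ for every $g\in F\setminus\{1\}$, where $g^G$ is the conjugacy class of $g$.
   Formalization: Families of subgroups are required to be non-empty; otherwise, for the trivial group, the empty family is vacuously separating but not semi-conjugacy-separating (take F = {1}). *)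

theory Defs
  imports "HOL-Algebra.Coset"
begin

definition conjugacy_class :: "('a, 'b) monoid_scheme \<Rightarrow> 'a \<Rightarrow> 'a set" where
  "conjugacy_class G g = {h \<otimes>\<^bsub>G\<^esub> g \<otimes>\<^bsub>G\<^esub> inv\<^bsub>G\<^esub> h | h. h \<in> carrier G}"

text \<open>
  Families are sets of subgroups and are required to be non-empty: over the trivial group the
  empty set of subgroups is vacuously separating (there is no non-empty subset of
  \<open>G \ {1}\<close>) but not semi-conjugacy-separating (take \<open>F = {1}\<close>). Over a non-trivial group both
  separation properties already force non-emptiness.
\<close>

definition finite_index_family :: "('a, 'b) monoid_scheme \<Rightarrow> 'a set set \<Rightarrow> bool" where
  "finite_index_family G \<sigma> \<longleftrightarrow>
     \<sigma> \<noteq> {} \<and> (\<forall>H\<in>\<sigma>. subgroup H G \<and> finite (rcosets\<^bsub>G\<^esub> H))"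

definition finite_index_normal_family :: "('a, 'b) monoid_scheme \<Rightarrow> 'a set set \<Rightarrow> bool" where
  "finite_index_normal_family G \<sigma> \<longleftrightarrow>
     finite_index_family G \<sigma> \<and> (\<forall>N\<in>\<sigma>. N \<lhd> G)"

definition separating :: "('a, 'b) monoid_scheme \<Rightarrow> 'a set set \<Rightarrow> bool" where
  "separating G \<sigma> \<longleftrightarrow>
     (\<forall>F. F \<noteq> {} \<and> finite F \<and> F \<subseteq> carrier G - {\<one>\<^bsub>G\<^esub>} \<longrightarrow>
        (\<exists>H\<in>\<sigma>. \<forall>g\<in>F. g \<notin> H))"

definition semi_conjugacy_separating :: "('a, 'b) monoid_scheme \<Rightarrow> 'a set set \<Rightarrow> bool" where
  "semi_conjugacy_separating G \<sigma> \<longleftrightarrow>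
     (\<forall>F. F \<noteq> {} \<and> finite F \<and> F \<subseteq> carrier G \<longrightarrow>
        (\<exists>H\<in>\<sigma>. \<forall>g\<in>F - {\<one>\<^bsub>G\<^esub>}. H \<inter> (conjugacy_class G g <#>\<^bsub>G\<^esub> H) = {}))"

end

theory Submission
  imports Defs
begin

text \<open>Let N be a normal subgroup and K a subset of N. If K meets g^G K, then c k lies in N for
  some conjugate c of g and some k in N, so c lies in N, and by normality so does g. Hence a normal
  N that avoids all nontrivial elements of F witnesses semi-conjugacy separation for F, and so does
  any member of the family contained in N (\<open>semi_conjugacy_separating_if_refines\<close>).
  Both claims are instances of this.\<close>

text \<open>Passing from \<open>H\<close> to a subset \<open>K\<close> only shrinks both sides of
  the intersection. Allowing such a \<open>K\<close> covers members of \<sigma> that lie inside a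
  normal subgroup without being normal themselves.\<close>

lemma (in normal) conjugacy_class_set_mult_disjoint:
  assumes g: "g \<in> carrier G" "g \<notin> H" and "K \<subseteq> H"
  shows "K \<inter> (conjugacy_class G g <#> K) = {}"
proof (rule ccontr)
  assume "K \<inter> (conjugacy_class G g <#> K) \<noteq> {}"
  then obtain h k where h: "h \<in> carrier G" and k: "k \<in> H"
    and hk: "h \<otimes> g \<otimes> inv h \<otimes> k \<in> H"
    using \<open>K \<subseteq> H\<close> by (auto simp: conjugacy_class_def set_mult_def)
  have "(h \<otimes> g \<otimes> inv h \<otimes> k) \<otimes> inv k = h \<otimes> g \<otimes> inv h"
    using g h k by (simp add: m_assoc)
  then have "h \<otimes> g \<otimes> inv h \<in> H"
    using subgroup.m_closed[OF is_subgroup hk subgroup.m_inv_closed[OF is_subgroup k]] by simp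
  \<comment> \<open>Normality enters here: conjugating back by \<open>inv h\<close> stays in
    \<open>H\<close> and recovers \<open>g\<close>.\<close>
  then have "inv h \<otimes> (h \<otimes> g \<otimes> inv h) \<otimes> h \<in> H"
    using h by (rule inv_op_closed1[rotated])
  moreover have "inv h \<otimes> (h \<otimes> g \<otimes> inv h) \<otimes> h = (inv h \<otimes> h) \<otimes> g \<otimes> (inv h \<otimes> h)"
    using g h by (simp only: m_assoc inv_closed monoid.m_closed[OF monoid_axioms])
  then have "inv h \<otimes> (h \<otimes> g \<otimes> inv h) \<otimes> h = g"
    using g h by simp
  ultimately show False
    using g by simp
qed

text \<open>Separation is applied to \<tau>, and the witness is then shrunk to a member of \<sigma>.
  Taking \<sigma> = \<tau> gives the statement about normal families.\<close>

lemma semi_conjugacy_separating_if_refines: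
  assumes \<tau>: "finite_index_normal_family G \<tau>" "separating G \<tau>"
    and refines: "\<forall>N\<in>\<tau>. \<exists>H\<in>\<sigma>. H \<subseteq> N"
  shows "semi_conjugacy_separating G \<sigma>"
  unfolding semi_conjugacy_separating_def
proof (intro allI impI)
  fix F
  assume F: "F \<noteq> {} \<and> finite F \<and> F \<subseteq> carrier G"
  have "\<exists>N\<in>\<tau>. \<forall>g\<in>F - {\<one>\<^bsub>G\<^esub>}. g \<notin> N"
  proof (cases "F - {\<one>\<^bsub>G\<^esub>} = {}")
    \<comment> \<open>Separation says nothing about the empty set, so any member of \<tau> is taken;
      one exists because families are non-empty.\<close>
    case True
    then show ?thesis
      using \<tau>(1) by (auto simp: finite_index_normal_family_def finite_index_family_def)
  next
    case False
    moreover have "finite (F - {\<one>\<^bsub>G\<^esub>})" "F - {\<one>\<^bsub>G\<^esub>} \<subseteq> carrier G - {\<one>\<^bsub>G\<^esub>}"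
      using F by auto
    ultimately show ?thesis
      using \<tau>(2)[unfolded separating_def, rule_format] by simp
  qed
  then obtain N where N: "N \<in> \<tau>" "\<forall>g\<in>F - {\<one>\<^bsub>G\<^esub>}. g \<notin> N"
    by blast
  then obtain H where H: "H \<in> \<sigma>" "H \<subseteq> N"
    using refines by blast
  have "N \<lhd> G"
    using \<tau>(1) N(1) by (simp add: finite_index_normal_family_def)
  then have "\<forall>g\<in>F - {\<one>\<^bsub>G\<^esub>}. H \<inter> (conjugacy_class G g <#>\<^bsub>G\<^esub> H) = {}"
    using N(2) H(2) F by (intro ballI normal.conjugacy_class_set_mult_disjoint[of N]) auto
  then show "\<exists>H\<in>\<sigma>. \<forall>g\<in>F - {\<one>\<^bsub>G\<^esub>}. H \<inter> (conjugacy_class G g <#>\<^bsub>G\<^esub> H) = {}"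
    using H(1) by blast
qed

theorem corollary3p13:
  fixes G :: "('a, 'b) monoid_scheme"
  assumes "group G"
  shows "(\<forall>\<sigma>. finite_index_normal_family G \<sigma> \<and> separating G \<sigma> \<longrightarrow>
            semi_conjugacy_separating G \<sigma>) \<and>
         (\<forall>\<sigma>. finite_index_family G \<sigma> \<and>
            (\<exists>\<tau>. finite_index_normal_family G \<tau> \<and> separating G \<tau> \<and>
               (\<forall>N\<in>\<tau>. \<exists>H\<in>\<sigma>. H \<subseteq> N)) \<longrightarrow>
            semi_conjugacy_separating G \<sigma>)"
  using semi_conjugacy_separating_if_refines[of G] by auto

end
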